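(* Let $f:(X,d)\to(Y,\rho)$ be a function between two metric spaces. Then the following are equivalent. (a) $f$ is uniformly continuous. (b) $f$ is TB-regular and the set of subsets of $X$ on which $f$ is uniformly continuous is closed under finite unions. (c) $f$ is TB-regular and the set of subsets of $X$ on which $f$ is uniformly continuous forms a bornology.
   Context: A subset $A$ of a metric space $(X,d)$ is totally bounded if for every $\epsilon>0$ there is a finite set $\{x_1,\dots,x_n\}\subseteq X$ with $A\subseteq\bigcup_{i=1}^n B(x_i,\epsilon)$, where $B(x,\epsilon)$ is the open ball. A (not necessarily continuous) function $f:(X,d)\to(Y,\rho)$ is TB-regular if $f(A)$ is totally bounded for every totally bounded subset $A$ of $X$. $f$ is uniformly continuous on a subset $A\subseteq X$ if the restriction $f|_A$ is uniformly continuous. A bornology on $X$ is a family $\mathbf{B}$ of non-empty subsets of $X$ that (i) covers $X$, (ii) is hereditary: if $A\in\mathbf{B}$ and $\emptyset\neq B\subseteq A$ then $B\in\mathbf{B}$, and (iii) is closed under finite unions. The subsets of $X$ considered here are non-empty. *)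

theory Defs
  imports "HOL-Analysis.Analysis"
begin

(* The library's totally_bounded is stated through the uniformity; in a metric space it is the
   usual covering condition by finitely many open balls with centres anywhere in the space. *)
lemma totally_bounded_iff_finite_ball_cover:
  fixes A :: "'a::metric_space set"
  shows "totally_bounded A \<longleftrightarrow> (\<forall>\<epsilon>>0. \<exists>F. finite F \<and> A \<subseteq> (\<Union>x\<in>F. ball x \<epsilon>))"
  by (simp add: totally_bounded_metric ball_def)

definition TB_regular :: "('a::metric_space \<Rightarrow> 'b::metric_space) \<Rightarrow> bool" where
  "TB_regular f \<longleftrightarrow> (\<forall>A. totally_bounded A \<longrightarrow> totally_bounded (f ` A))"

(* The empty union is excluded, since the families considered consist of non-empty sets. *)
definition closed_under_finite_unions :: "'a set set \<Rightarrow> bool" where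
  "closed_under_finite_unions \<B> \<longleftrightarrow>
     (\<forall>\<F>. finite \<F> \<and> \<F> \<noteq> {} \<and> \<F> \<subseteq> \<B> \<longrightarrow> \<Union>\<F> \<in> \<B>)"

(* A bornology on the whole underlying type. *)
definition bornology :: "'a set set \<Rightarrow> bool" where
  "bornology \<B> \<longleftrightarrow>
     {} \<notin> \<B> \<and>
     \<Union>\<B> = UNIV \<and>
     (\<forall>A\<in>\<B>. \<forall>B. B \<noteq> {} \<and> B \<subseteq> A \<longrightarrow> B \<in> \<B>) \<and>
     closed_under_finite_unions \<B>"

definition uniform_continuity_sets ::
    "('a::metric_space \<Rightarrow> 'b::metric_space) \<Rightarrow> 'a set set" where
  "uniform_continuity_sets f = {A. A \<noteq> {} \<and> uniformly_continuous_on A f}"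

end

theory Submission
  imports Defs
begin

text \<open>
  The substance is that a TB-regular function \<open>f\<close>, continuous or not, is uniformly continuous on
  the range of a subsequence of any given sequence \<open>x\<close>
  (\<open>TB_regular_imp_subseq_uniformly_continuous\<close>). If the range of \<open>x\<close> is not totally bounded, a
  subsequence is uniformly separated, and every function is uniformly continuous on a uniformly
  separated set. If the range is totally bounded, so is its image, and along some subsequence both
  \<open>x\<close> and \<open>f \<circ> x\<close> are Cauchy. That alone does not suffice, because \<open>f\<close> may jump at a limit
  of \<open>x\<close> belonging to the range. The subsequence is therefore thinned further, until it is
  constant or none of its terms is its limit. In the latter case each term lies at a positive
  distance from all other points of the range, so only the tail, where \<open>f\<close> oscillates little, has
  points close together.

  If \<open>f\<close> is not uniformly continuous, there are \<open>x\<close> and \<open>y\<close> with \<open>dist (x n) (y n)\<close> tending to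
  zero while \<open>f (x n)\<close> and \<open>f (y n)\<close> stay apart. Applying the lemma twice gives a common
  subsequence along which \<open>f\<close> is uniformly continuous on the range of \<open>x\<close> and on the range of
  \<open>y\<close>. It is not uniformly continuous on their union, so closure under finite unions fails.

  Conversely, a uniformly continuous \<open>f\<close> maps finite covers by small balls to finite covers by small
  balls, and its sets of uniform continuity are all the non-empty sets.
\<close>

section \<open>Subsequences of sequences with and without totally bounded range\<close>

text \<open>
  The ball covers of the uniform notion may have centres anywhere in the space, those of the abstract
  metric notion only in the set itself. Identifying the two gives access to the sequential
  characterisation of the latter.
\<close>
lemma totally_bounded_imp_mtotally_bounded:
  fixes S :: "'a::metric_space set"
  assumes "totally_bounded S"
  shows "Met_TC.mtotally_bounded S"
  unfolding Met_TC.mtotally_bounded_def mball_eq_ball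
proof (intro allI impI)
  fix e :: real assume "e > 0"
  then obtain F where F: "finite F" "S \<subseteq> (\<Union>x\<in>F. ball x (e/2))"
    using assms unfolding totally_bounded_iff_finite_ball_cover by (meson half_gt_zero)
  \<comment> \<open>Each centre whose ball meets \<open>S\<close> is replaced by a point of \<open>S\<close> in that ball, which is why
      the cover is taken at half the radius.\<close>
  define G where "G = {x\<in>F. ball x (e/2) \<inter> S \<noteq> {}}"
  have "\<forall>x\<in>G. \<exists>s. s \<in> ball x (e/2) \<inter> S" unfolding G_def by blast
  then obtain c where c: "\<And>x. x \<in> G \<Longrightarrow> c x \<in> ball x (e/2) \<inter> S" by metis
  have "finite G" using F by (simp add: G_def)
  moreover have "S \<subseteq> (\<Union>s\<in>c ` G. ball s e)"
  proof
    fix s assume s: "s \<in> S"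
    then obtain x where x: "x \<in> F" "dist x s < e/2" using F by auto
    with s have "x \<in> G" by (auto simp: G_def)
    moreover from c[OF this] have "dist (c x) s < e"
      using x dist_triangle_half_r[of x "c x" e s] by auto
    ultimately show "s \<in> (\<Union>s\<in>c ` G. ball s e)" by auto
  qed
  ultimately show "\<exists>K. finite K \<and> K \<subseteq> S \<and> S \<subseteq> (\<Union>x\<in>K. ball x e)"
    using c by (intro exI[of _ "c ` G"]) auto
qed

lemma totally_bounded_iff_mtotally_bounded:
  fixes S :: "'a::metric_space set"
  shows "totally_bounded S \<longleftrightarrow> Met_TC.mtotally_bounded S"
proof
  assume "Met_TC.mtotally_bounded S"
  then show "totally_bounded S"
    unfolding totally_bounded_iff_finite_ball_cover Met_TC.mtotally_bounded_def mball_eq_ball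
    by blast
qed (rule totally_bounded_imp_mtotally_bounded)

lemma totally_bounded_imp_Cauchy_subseq:
  fixes x :: "nat \<Rightarrow> 'a::metric_space"
  assumes "totally_bounded S" "range x \<subseteq> S"
  obtains r :: "nat \<Rightarrow> nat" where "strict_mono r" "Cauchy (x \<circ> r)"
  using assms that
  unfolding totally_bounded_iff_mtotally_bounded Met_TC.mtotally_bounded_sequentially
    MCauchy_iff_Cauchy by blast

text \<open>
  Some radius admits no finite cover by balls centred at terms of the sequence, so beyond any index
  there is a term far from all the terms up to that index.
\<close>
lemma not_totally_bounded_imp_separated_subseq:
  fixes x :: "nat \<Rightarrow> 'a::metric_space"
  assumes "\<not> totally_bounded (range x)"
  obtains r :: "nat \<Rightarrow> nat" and e where "strict_mono r" "e > 0"
    "\<And>i j. i \<noteq> j \<Longrightarrow> e \<le> dist (x (r i)) (x (r j))"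
proof -
  obtain e where e: "e > 0" "\<And>F. finite F \<Longrightarrow> \<not> range x \<subseteq> (\<Union>a\<in>F. ball a e)"
    using assms unfolding totally_bounded_iff_finite_ball_cover by blast
  have step: "\<exists>m>n. \<forall>i\<le>n. e \<le> dist (x i) (x m)" for n
  proof -
    obtain m where m: "x m \<notin> (\<Union>a\<in>x ` {..n}. ball a e)"
      using e(2)[of "x ` {..n}"] by blast
    have far: "\<forall>i\<le>n. e \<le> dist (x i) (x m)" using m by (auto simp: not_less)
    have "m > n"
    proof (rule ccontr)
      assume "\<not> m > n"
      with far have "e \<le> dist (x m) (x m)" by (meson not_less)
      with e(1) show False by simp
    qed
    with far show ?thesis by blast
  qed
  obtain r where r: "\<And>n. r n < r (Suc n)"
      "\<And>n i. i \<le> r n \<Longrightarrow> e \<le> dist (x i) (x (r (Suc n)))"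
    using dependent_nat_choice[of "\<lambda>_ _. True" "\<lambda>_ a b. a < b \<and> (\<forall>i\<le>a. e \<le> dist (x i) (x b))"]
      step by blast
  have mono: "strict_mono r" using r(1) by (simp add: strict_mono_Suc_iff)
  have sep: "e \<le> dist (x (r i)) (x (r j))" if "i < j" for i j
  proof -
    obtain k where "j = Suc k" "i \<le> k" using \<open>i < j\<close> by (cases j) auto
    with r(2)[of "r i" k] mono show ?thesis by (simp add: strict_mono_less_eq)
  qed
  have "e \<le> dist (x (r i)) (x (r j))" if "i \<noteq> j" for i j
    using that sep[of i j] sep[of j i] by (auto simp: dist_commute neq_iff)
  then show thesis using that mono e(1) by blast
qed

section \<open>Uniform continuity on the range of a sequence\<close>

lemma uniformly_continuous_on_separated:
  fixes f :: "'a::metric_space \<Rightarrow> 'b::metric_space"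
  assumes "e > 0" "\<And>a b. a \<in> A \<Longrightarrow> b \<in> A \<Longrightarrow> a \<noteq> b \<Longrightarrow> e \<le> dist a b"
  shows "uniformly_continuous_on A f"
  unfolding uniformly_continuous_on_def using assms by (metis dist_self not_less)

text \<open>
  A Cauchy sequence that does not converge to \<open>p\<close> eventually stays a positive distance away from
  \<open>p\<close>, and the finitely many remaining terms other than \<open>p\<close> do so trivially.
\<close>
lemma Cauchy_not_limit_imp_isolated:
  fixes x :: "nat \<Rightarrow> 'a::metric_space"
  assumes "Cauchy x" "\<not> x \<longlonglongrightarrow> p"
  shows "\<exists>d>0. \<forall>n. x n \<noteq> p \<longrightarrow> d \<le> dist p (x n)"
proof -
  obtain e where e: "e > 0" "\<And>N. \<exists>n\<ge>N. e \<le> dist (x n) p"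
    using assms(2) unfolding lim_sequentially by (meson not_less)
  obtain N where N: "\<And>m n. m \<ge> N \<Longrightarrow> n \<ge> N \<Longrightarrow> dist (x m) (x n) < e/2"
    using assms(1) e(1) unfolding Cauchy_def by (meson half_gt_zero)
  obtain k where k: "k \<ge> N" "e \<le> dist (x k) p" using e(2) by blast
  have tail: "e/2 \<le> dist p (x n)" if "n \<ge> N" for n
    using dist_triangle[of "x k" p "x n"] N[OF k(1) that] k(2) by (simp add: dist_commute)
  obtain d where d: "d > 0" "\<forall>a\<in>x ` {..<N}. a \<noteq> p \<longrightarrow> d \<le> dist p a"
    using finite_set_avoid[of "x ` {..<N}" p] by blast
  have "min d (e/2) \<le> dist p (x n)" if "x n \<noteq> p" for n
    using tail[of n] d(2) that by (cases "n < N") (auto simp: min_le_iff_disj)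
  with e(1) d(1) show ?thesis by (intro exI[of _ "min d (e/2)"]) auto
qed

text \<open>
  Two distinct points of the range that are closer than the isolation radius of each of the first
  \<open>N\<close> terms both occur in the tail from \<open>N\<close> on, where \<open>f \<circ> x\<close> varies little.
\<close>
lemma uniformly_continuous_on_range_Cauchy:
  fixes f :: "'a::metric_space \<Rightarrow> 'b::metric_space"
  assumes "Cauchy x" "Cauchy (f \<circ> x)" "\<And>m. \<not> x \<longlonglongrightarrow> x m"
  shows "uniformly_continuous_on (range x) f"
  unfolding uniformly_continuous_on_def
proof (intro allI impI)
  fix e :: real assume "e > 0"
  then obtain N where N: "\<And>m n. m \<ge> N \<Longrightarrow> n \<ge> N \<Longrightarrow> dist (f (x m)) (f (x n)) < e"
    using assms(2) unfolding Cauchy_def by fastforce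
  obtain d where d: "\<And>m. d m > 0" "\<And>m n. x n \<noteq> x m \<Longrightarrow> d m \<le> dist (x m) (x n)"
    using Cauchy_not_limit_imp_isolated[OF assms(1) assms(3)] by metis
  \<comment> \<open>The 1 only keeps the minimum defined when \<open>N = 0\<close>.\<close>
  define \<delta> where "\<delta> = Min (insert 1 (d ` {..<N}))"
  have "\<delta> > 0" using d(1) by (simp add: \<delta>_def)
  have \<delta>: "\<delta> \<le> d m" if "m < N" for m using that by (simp add: \<delta>_def)
  have "dist (f (x m)) (f (x n)) < e" if close: "dist (x m) (x n) < \<delta>" for m n
  proof (cases "x m = x n \<or> (m \<ge> N \<and> n \<ge> N)")
    case True
    with N \<open>e > 0\<close> show ?thesis by auto
  next
    case False
    then have "\<delta> \<le> dist (x m) (x n)"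
      using \<delta>[of m] \<delta>[of n] d(2)[of n m] d(2)[of m n] by (force simp: dist_commute)
    with close show ?thesis by simp
  qed
  with \<open>\<delta> > 0\<close>
  show "\<exists>d>0. \<forall>a\<in>range x. \<forall>b\<in>range x. dist b a < d \<longrightarrow> dist (f b) (f a) < e"
    by blast
qed

text \<open>
  A subsequence is needed because a limit of \<open>x\<close> that occurs among its terms may be mapped away
  from the limit of \<open>f \<circ> x\<close>. Either some value is taken infinitely often, and a constant
  subsequence will do, or such a limit can be cut off.
\<close>
lemma Cauchy_imp_subseq_uniformly_continuous:
  fixes f :: "'a::metric_space \<Rightarrow> 'b::metric_space"
  assumes "Cauchy x" "Cauchy (f \<circ> x)"
  obtains r :: "nat \<Rightarrow> nat" where "strict_mono r" "uniformly_continuous_on (range (x \<circ> r)) f"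
proof (cases "\<exists>p. infinite {n. x n = p}")
  case True
  then obtain p where "infinite {n. x n = p}" by blast
  then obtain r :: "nat \<Rightarrow> nat" where r: "strict_mono r" "\<And>n. x (r n) = p"
    using infinite_enumerate by blast
  have "uniformly_continuous_on (range (x \<circ> r)) f"
    by (rule uniformly_continuous_on_separated[of 1]) (auto simp: r(2))
  with r(1) that show ?thesis by blast
next
  case False
  \<comment> \<open>The limit, if there is one, is attained only finitely often and so is avoided by a tail.\<close>
  have "\<exists>N. \<forall>m\<ge>N. \<not> x \<longlonglongrightarrow> x m"
  proof (cases "\<exists>p. x \<longlonglongrightarrow> p")
    case True
    then obtain p where p: "x \<longlonglongrightarrow> p" by blast
    obtain N where "\<forall>n\<in>{n. x n = p}. n < N"
      using False finite_nat_set_iff_bounded by blast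
    then have "\<forall>m\<ge>N. x m \<noteq> p" by auto
    with p show ?thesis using LIMSEQ_unique by blast
  qed blast
  then obtain N where N: "\<And>m. m \<ge> N \<Longrightarrow> \<not> x \<longlonglongrightarrow> x m" by blast
  define r where "r n = n + N" for n
  have r: "strict_mono r" by (simp add: r_def strict_mono_def)
  have "uniformly_continuous_on (range (x \<circ> r)) f"
  proof (rule uniformly_continuous_on_range_Cauchy)
    show "Cauchy (x \<circ> r)" using Cauchy_subseq_Cauchy assms(1) r by blast
    show "Cauchy (f \<circ> (x \<circ> r))"
      using Cauchy_subseq_Cauchy[OF assms(2) r] by (simp add: comp_assoc)
    show "\<not> (x \<circ> r) \<longlonglongrightarrow> (x \<circ> r) m" for m
      using N[of "m + N"] LIMSEQ_offset[of x N] by (auto simp: r_def comp_def)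
  qed
  with r that show ?thesis by blast
qed

lemma TB_regular_imp_subseq_uniformly_continuous:
  fixes f :: "'a::metric_space \<Rightarrow> 'b::metric_space" and x :: "nat \<Rightarrow> 'a"
  assumes "TB_regular f"
  obtains r :: "nat \<Rightarrow> nat" where "strict_mono r" "uniformly_continuous_on (range (x \<circ> r)) f"
proof (cases "totally_bounded (range x)")
  case True
  then obtain r :: "nat \<Rightarrow> nat" where r: "strict_mono r" "Cauchy (x \<circ> r)"
    by (rule totally_bounded_imp_Cauchy_subseq[OF _ subset_refl])
  have "totally_bounded (f ` range x)"
    using True assms by (simp add: TB_regular_def)
  then obtain s :: "nat \<Rightarrow> nat" where s: "strict_mono s" "Cauchy ((f \<circ> x \<circ> r) \<circ> s)"
    by (rule totally_bounded_imp_Cauchy_subseq[of _ "f \<circ> x \<circ> r"]) auto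
  have "Cauchy (x \<circ> r \<circ> s)" using Cauchy_subseq_Cauchy r(2) s(1) by blast
  moreover have "Cauchy (f \<circ> (x \<circ> r \<circ> s))" using s(2) by (simp add: comp_assoc)
  ultimately obtain t :: "nat \<Rightarrow> nat" where t: "strict_mono t"
      "uniformly_continuous_on (range (x \<circ> r \<circ> s \<circ> t)) f"
    by (rule Cauchy_imp_subseq_uniformly_continuous)
  show ?thesis
  proof (rule that[of "r \<circ> s \<circ> t"])
    show "strict_mono (r \<circ> s \<circ> t)" by (intro strict_mono_o r s t)
    show "uniformly_continuous_on (range (x \<circ> (r \<circ> s \<circ> t))) f"
      using t(2) by (simp add: comp_assoc)
  qed
next
  case False
  then show ?thesis
  proof (rule not_totally_bounded_imp_separated_subseq)
    fix r :: "nat \<Rightarrow> nat" and e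
    assume r: "strict_mono r" "e > 0" "\<And>i j. i \<noteq> j \<Longrightarrow> e \<le> dist (x (r i)) (x (r j))"
    have "uniformly_continuous_on (range (x \<circ> r)) f"
    proof (rule uniformly_continuous_on_separated[OF r(2)])
      fix a b assume "a \<in> range (x \<circ> r)" "b \<in> range (x \<circ> r)" "a \<noteq> b"
      then obtain i j where "a = x (r i)" "b = x (r j)" "i \<noteq> j" by auto
      with r(3)[of i j] show "e \<le> dist a b" by simp
    qed
    with r(1) that show ?thesis by blast
  qed
qed

section \<open>Uniform continuity on the whole space\<close>

lemma TB_regular_unions_imp_uniformly_continuous:
  fixes f :: "'a::metric_space \<Rightarrow> 'b::metric_space"
  assumes TB: "TB_regular f" and Un: "closed_under_finite_unions (uniform_continuity_sets f)"
  shows "uniformly_continuous_on UNIV f"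
proof (rule ccontr)
  assume "\<not> uniformly_continuous_on UNIV f"
  then obtain e where e: "e > 0"
      "\<And>d. d > 0 \<Longrightarrow> \<exists>a b. dist a b < d \<and> e \<le> dist (f a) (f b)"
    unfolding uniformly_continuous_on_def by (meson not_less)
  have "\<forall>n. \<exists>a b. dist a b < inverse (real (Suc n)) \<and> e \<le> dist (f a) (f b)"
    using e(2) by simp
  then obtain x y where xy: "\<And>n. dist (x n) (y n) < inverse (real (Suc n))"
      "\<And>n. e \<le> dist (f (x n)) (f (y n))"
    by metis
  obtain r :: "nat \<Rightarrow> nat" where r: "strict_mono r" "uniformly_continuous_on (range (x \<circ> r)) f"
    by (rule TB_regular_imp_subseq_uniformly_continuous[OF TB])
  obtain s :: "nat \<Rightarrow> nat" where s: "strict_mono s"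
      "uniformly_continuous_on (range (y \<circ> r \<circ> s)) f"
    by (rule TB_regular_imp_subseq_uniformly_continuous[OF TB])
  \<comment> \<open>Thinning by \<open>s\<close> for the sake of \<open>y\<close> keeps what \<open>r\<close> achieved for \<open>x\<close>: the range only shrinks.\<close>
  define A where "A = range (x \<circ> r \<circ> s)"
  define B where "B = range (y \<circ> r \<circ> s)"
  have "A \<subseteq> range (x \<circ> r)" by (auto simp: A_def)
  with r(2) have "uniformly_continuous_on A f"
    unfolding uniformly_continuous_on_def by (meson subset_iff)
  then have "A \<in> uniform_continuity_sets f"
    by (simp add: uniform_continuity_sets_def A_def)
  moreover have "B \<in> uniform_continuity_sets f"
    using s(2) by (simp add: uniform_continuity_sets_def B_def)
  ultimately have "\<Union>{A, B} \<in> uniform_continuity_sets f"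
    using Un[unfolded closed_under_finite_unions_def, THEN spec, of "{A, B}"] by simp
  then have "uniformly_continuous_on (A \<union> B) f"
    by (simp add: uniform_continuity_sets_def)
  then obtain d where d: "d > 0"
      "\<And>a b. a \<in> A \<union> B \<Longrightarrow> b \<in> A \<union> B \<Longrightarrow> dist a b < d \<Longrightarrow> dist (f a) (f b) < e"
    using e(1) unfolding uniformly_continuous_on_def by metis
  obtain n where n: "inverse (real (Suc n)) < d" using reals_Archimedean[OF d(1)] by blast
  let ?k = "r (s n)"
  have "n \<le> ?k"
    using strict_mono_imp_increasing[OF strict_mono_o[OF r(1) s(1)]] by simp
  then have "inverse (real (Suc ?k)) \<le> inverse (real (Suc n))"
    by (intro le_imp_inverse_le) auto
  with xy(1)[of ?k] n have "dist (x ?k) (y ?k) < d" by linarith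
  then have "dist (f (x ?k)) (f (y ?k)) < e"
    by (intro d(2)) (auto simp: A_def B_def)
  with xy(2)[of ?k] show False by simp
qed

lemma uniformly_continuous_imp_TB_regular:
  fixes f :: "'a::metric_space \<Rightarrow> 'b::metric_space"
  assumes "uniformly_continuous_on UNIV f"
  shows "TB_regular f"
  unfolding TB_regular_def totally_bounded_iff_finite_ball_cover
proof (intro allI impI)
  fix A :: "'a set" and e :: real
  assume A: "\<forall>\<epsilon>>0. \<exists>F. finite F \<and> A \<subseteq> (\<Union>x\<in>F. ball x \<epsilon>)" and "e > 0"
  then obtain d where d: "d > 0" "\<And>a b. dist a b < d \<Longrightarrow> dist (f a) (f b) < e"
    using assms unfolding uniformly_continuous_on_def by (metis UNIV_I)
  obtain F where "finite F" "A \<subseteq> (\<Union>x\<in>F. ball x d)" using A d(1) by blast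
  then show "\<exists>F. finite F \<and> f ` A \<subseteq> (\<Union>y\<in>F. ball y e)"
    using d(2) by (intro exI[of _ "f ` F"]) fastforce
qed

lemma uniformly_continuous_imp_bornology:
  fixes f :: "'a::metric_space \<Rightarrow> 'b::metric_space"
  assumes "uniformly_continuous_on UNIV f"
  shows "bornology (uniform_continuity_sets f)"
proof -
  have "uniformly_continuous_on A f" for A
    using assms unfolding uniformly_continuous_on_def by (metis UNIV_I)
  then have "uniform_continuity_sets f = {A. A \<noteq> {}}"
    by (simp add: uniform_continuity_sets_def)
  then show ?thesis
    by (auto simp: bornology_def closed_under_finite_unions_def)
qed

theorem theorem7:
  fixes f :: "'a::metric_space \<Rightarrow> 'b::metric_space"
  shows "(uniformly_continuous_on UNIV f \<longleftrightarrow>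
            TB_regular f \<and> closed_under_finite_unions (uniform_continuity_sets f)) \<and>
         (uniformly_continuous_on UNIV f \<longleftrightarrow>
            TB_regular f \<and> bornology (uniform_continuity_sets f))"
proof -
  have "bornology (uniform_continuity_sets f) \<Longrightarrow>
      closed_under_finite_unions (uniform_continuity_sets f)"
    by (simp add: bornology_def)
  then show ?thesis
    using TB_regular_unions_imp_uniformly_continuous[of f]
      uniformly_continuous_imp_TB_regular[of f] uniformly_continuous_imp_bornology[of f] by blast
qed

end
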